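(* (Dual Orlicz-Urysohn inequality) Let $K\in\mathcal{S}_0$ be a star body about the origin in $\mathbb{R}^n$ and let $\phi:(0,\infty)\to(0,\infty)$ be continuous. If $F(t)=\phi(t^{1/n})$ is concave, then $$\widetilde{\omega}_\phi(K)\leq\widetilde{\omega}_\phi(B_K),$$ while if $F$ is convex, the inequality is reversed. If $F$ is strictly concave (or strictly convex, as appropriate), equality holds if and only if $K$ is an origin-symmetric Euclidean ball.
   Context: $B_2^n$ is the closed unit Euclidean ball of $\mathbb{R}^n$, $S^{n-1}$ the unit sphere, $\sigma$ the spherical measure, $|\cdot|$ volume, $\omega_n=|B_2^n|$. A compact set $K$ that contains the closed segment from the origin to each of its points has radial function $\rho_K(u)=\max\{\lambda:\lambda u\in K\}$, $u\in S^{n-1}$; $K$ is a star body about the origin ($K\in\mathcal{S}_0$) if $\rho_K$ is continuous and positive on $S^{n-1}$. $\mathrm{vrad}(K)=(|K|/\omega_n)^{1/n}$ and $B_K=\mathrm{vrad}(K)B_2^n$. The Orlicz $L_\phi$ mean radius of $K$ is $$\widetilde{\omega}_\phi(K)=\frac{1}{n\omega_n}\int_{S^{n-1}}\phi\big(\rho_K(u)\big)\,d\sigma(u).$$ An origin-symmetric Euclidean ball is $rB_2^n$ with $r>0$. *)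

theory Defs
  imports "HOL-Analysis.Analysis"
begin

text \<open>
  The library has no surface measure. The spherical (surface area) measure on the Borel sets of
  the unit sphere is defined as the cone measure
  \<open>\<sigma>(A) = n \<cdot> |{r u : 0 < r \<le> 1, u \<in> A}|\<close>, i.e. as \<open>n\<close> times the image of Lebesgue
  measure on the punctured unit ball under the radial projection. The lemmas below record this
  formula, the total mass \<open>n \<omega>\<^sub>n\<close> and invariance under orthogonal maps (where the sort
  constraint is inherited from the library's change-of-variables theorem).
\<close>

definition spherical_measure :: "(real ^ 'n) measure" where
  "spherical_measure =
     distr (scale_measure (of_nat CARD('n)) (restrict_space lborel (cball 0 1 - {0})))
       (restrict_space borel (sphere 0 1)) (\<lambda>x. x /\<^sub>R norm x)"

lemma space_spherical_measure: "space (spherical_measure :: (real ^ 'n) measure) = sphere 0 1"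
  by (simp add: spherical_measure_def space_restrict_space)

lemma sets_spherical_measure:
  "sets (spherical_measure :: (real ^ 'n) measure) = sets (restrict_space borel (sphere 0 1))"
  by (simp add: spherical_measure_def)

lemma measurable_radial_projection:
  "(\<lambda>x :: real ^ 'n. x /\<^sub>R norm x) \<in>
     scale_measure c (restrict_space lborel (cball 0 1 - {0})) \<rightarrow>\<^sub>M restrict_space borel (sphere 0 1)"
proof (rule measurable_restrict_space2)
  show "(\<lambda>x :: real ^ 'n. x /\<^sub>R norm x)
      \<in> space (scale_measure c (restrict_space lborel (cball 0 1 - {0}))) \<rightarrow> sphere 0 1"
    by (auto simp: space_scale_measure space_restrict_space)
  have "(\<lambda>x :: real ^ 'n. x /\<^sub>R norm x) \<in> borel_measurable (restrict_space lborel (cball 0 1 - {0}))"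
    by (rule measurable_restrict_space1) measurable
  then show "(\<lambda>x :: real ^ 'n. x /\<^sub>R norm x)
      \<in> borel_measurable (scale_measure c (restrict_space lborel (cball 0 1 - {0})))"
    by (simp cong: measurable_cong_sets add: measurable_def space_scale_measure)
qed

lemma emeasure_spherical_measure:
  fixes A :: "(real ^ 'n) set"
  assumes "A \<in> sets spherical_measure"
  shows "emeasure spherical_measure A =
    of_nat CARD('n) * emeasure lborel {r *\<^sub>R u | r u. 0 < r \<and> r \<le> 1 \<and> u \<in> A}"
proof -
  let ?B = "cball 0 1 - {0} :: (real ^ 'n) set"
  have A: "A \<in> sets (restrict_space borel (sphere 0 1))"
    using assms by (simp add: sets_spherical_measure)
  then have sub: "A \<subseteq> sphere 0 1"
    by (auto simp: sets_restrict_space)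
  have eq: "(\<lambda>x. x /\<^sub>R norm x) -` A \<inter> ?B = {r *\<^sub>R u | r u. 0 < r \<and> r \<le> 1 \<and> u \<in> A}"
  proof (intro equalityI subsetI)
    fix x assume x: "x \<in> (\<lambda>x. x /\<^sub>R norm x) -` A \<inter> ?B"
    then have "x = norm x *\<^sub>R (x /\<^sub>R norm x)" "0 < norm x" "norm x \<le> 1" "x /\<^sub>R norm x \<in> A"
      by auto
    then show "x \<in> {r *\<^sub>R u | r u. 0 < r \<and> r \<le> 1 \<and> u \<in> A}"
      by blast
  next
    fix x assume "x \<in> {r *\<^sub>R u | r u. 0 < r \<and> r \<le> 1 \<and> u \<in> A}"
    then obtain r u where x: "x = r *\<^sub>R u" "0 < r" "r \<le> 1" "u \<in> A"
      by blast
    then have "norm u = 1"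
      using sub by auto
    with x show "x \<in> (\<lambda>x. x /\<^sub>R norm x) -` A \<inter> ?B"
      by auto
  qed
  have "emeasure spherical_measure A = of_nat CARD('n) *
      emeasure (restrict_space lborel ?B) ((\<lambda>x. x /\<^sub>R norm x) -` A \<inter> ?B)"
    unfolding spherical_measure_def
    by (subst emeasure_distr[OF measurable_radial_projection A])
      (simp add: space_scale_measure space_restrict_space)
  also have "emeasure (restrict_space lborel ?B) ((\<lambda>x. x /\<^sub>R norm x) -` A \<inter> ?B) =
      emeasure lborel ((\<lambda>x. x /\<^sub>R norm x) -` A \<inter> ?B)"
    by (rule emeasure_restrict_space) auto
  finally show ?thesis
    by (simp add: eq)
qed

lemma emeasure_spherical_measure_sphere:
  "emeasure (spherical_measure :: (real ^ 'n) measure) (sphere 0 1) =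
     of_nat CARD('n) * emeasure lborel (cball 0 1 :: (real ^ 'n) set)"
proof -
  let ?C = "{r *\<^sub>R u | r u. 0 < r \<and> r \<le> 1 \<and> u \<in> sphere 0 1} :: (real ^ 'n) set"
  have "?C = cball 0 1 - {0}"
  proof (intro equalityI subsetI)
    fix x :: "real ^ 'n" assume "x \<in> cball 0 1 - {0}"
    then have "x = norm x *\<^sub>R (x /\<^sub>R norm x)" "0 < norm x" "norm x \<le> 1" "x /\<^sub>R norm x \<in> sphere 0 1"
      by auto
    then show "x \<in> ?C"
      by blast
  qed auto
  moreover have "emeasure lborel (cball 0 1 - {0} :: (real ^ 'n) set) = emeasure lborel (cball 0 1 :: (real ^ 'n) set)"
    by (subst emeasure_Diff) auto
  moreover have "sphere 0 1 \<in> sets (spherical_measure :: (real ^ 'n) measure)"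
    by (metis sets.top space_spherical_measure)
  ultimately show ?thesis
    by (simp only: emeasure_spherical_measure)
qed

lemma emeasure_spherical_measure_orthogonal_image:
  fixes A :: "(real ^ 'n::{finite,wellorder}) set" and f :: "real ^ 'n::{finite,wellorder} \<Rightarrow> real ^ 'n::{finite,wellorder}"
  assumes f: "orthogonal_transformation f" and A: "A \<in> sets spherical_measure"
  shows "emeasure spherical_measure (f ` A) = emeasure spherical_measure A"
proof -
  let ?C = "\<lambda>A :: (real ^ 'n::{finite,wellorder}) set. {r *\<^sub>R u | r u. 0 < r \<and> r \<le> 1 \<and> u \<in> A}"
  let ?p = "\<lambda>x :: real ^ 'n::{finite,wellorder}. x /\<^sub>R norm x"
  have lin: "linear f"
    using f by (rule orthogonal_transformation_linear)
  have inv: "orthogonal_transformation (inv f)"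
    using f by (rule orthogonal_transformation_inv)
  have bij: "bij f"
    using f by (rule orthogonal_transformation_bij)
  have contf: "f \<in> borel_measurable borel" "inv f \<in> borel_measurable borel"
    using lin inv by (auto intro!: borel_measurable_continuous_onI linear_continuous_on
        simp: linear_conv_bounded_linear[symmetric] orthogonal_transformation_linear)
  have AB: "A \<in> sets borel" "A \<subseteq> sphere 0 1"
    using A by (auto simp: sets_spherical_measure sets_restrict_space)
  have C_borel: "?C B \<in> sets borel" if "B \<in> sets borel" "B \<subseteq> sphere 0 1" for B
  proof -
    have "?C B = ?p -` B \<inter> (cball 0 1 - {0})"
    proof (intro equalityI subsetI)
      fix x assume "x \<in> ?p -` B \<inter> (cball 0 1 - {0})"
      then have "x = norm x *\<^sub>R (x /\<^sub>R norm x)" "0 < norm x" "norm x \<le> 1" "x /\<^sub>R norm x \<in> B"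
        by auto
      then show "x \<in> ?C B"
        by blast
    next
      fix x assume "x \<in> ?C B"
      then obtain r u where x: "x = r *\<^sub>R u" "0 < r" "r \<le> 1" "u \<in> B"
        by blast
      then have "norm u = 1"
        using that by auto
      with x show "x \<in> ?p -` B \<inter> (cball 0 1 - {0})"
        by auto
    qed
    moreover have "?p \<in> borel_measurable borel"
      by measurable
    then have "?p -` B \<in> sets borel"
      using measurable_sets[of ?p borel borel B] that by simp
    ultimately show ?thesis
      by auto
  qed
  have "f ` A = inv f -` A"
    using bij by (simp add: bij_vimage_eq_inv_image bij_imp_bij_inv inv_inv_eq)
  then have fA: "f ` A \<in> sets borel"
    using measurable_sets[OF contf(2), of A] AB by simp
  have fS: "f ` A \<subseteq> sphere 0 1"
    using AB f by (auto simp: orthogonal_transformation_norm)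
  have C_sub: "?C B \<subseteq> cball 0 1" if "B \<subseteq> sphere 0 1" for B
    using that by (auto simp: subset_iff)
  have C_lm: "?C B \<in> lmeasurable" if "B \<in> sets borel" "B \<subseteq> sphere 0 1" for B
    using C_borel[OF that] C_sub[OF that(2)]
    by (intro bounded_set_imp_lmeasurable) (auto intro: bounded_subset[OF bounded_cball])
  have "?C (f ` A) = f ` ?C A"
    using lin by (force simp: linear_cmul image_def)
  then have "measure lebesgue (?C (f ` A)) = measure lebesgue (?C A)"
    using measure_orthogonal_image[OF f C_lm[OF AB]] by simp
  then have "emeasure lebesgue (?C (f ` A)) = emeasure lebesgue (?C A)"
    using C_lm[OF AB] C_lm[OF fA fS] by (simp add: emeasure_eq_measure2 fmeasurableD2)
  then have "emeasure lborel (?C (f ` A)) = emeasure lborel (?C A)"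
    using C_borel[OF AB] C_borel[OF fA fS] by simp
  moreover have "f ` A \<in> sets spherical_measure"
    using fA fS by (auto simp: sets_spherical_measure sets_restrict_space)
  ultimately show ?thesis
    using A by (simp add: emeasure_spherical_measure)
qed

definition radial_function :: "(real ^ 'n) set \<Rightarrow> real ^ 'n \<Rightarrow> real" where
  "radial_function K u = (GREATEST l. l *\<^sub>R u \<in> K)"

text \<open>
  Nonemptiness makes the maximum in the radial function exist; it is implicit in
  \<open>\<rho>\<^sub>K\<close> being defined.
\<close>

definition star_body :: "(real ^ 'n) set \<Rightarrow> bool" where
  "star_body K \<longleftrightarrow>
     K \<noteq> {} \<and> compact K \<and> (\<forall>x\<in>K. closed_segment 0 x \<subseteq> K) \<and>
     continuous_on (sphere 0 1) (radial_function K) \<and>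
     (\<forall>u\<in>sphere 0 1. radial_function K u > 0)"

definition vrad :: "(real ^ 'n) set \<Rightarrow> real" where
  "vrad K = root CARD('n) (measure lborel K / measure lborel (cball 0 1 :: (real ^ 'n) set))"

definition vrad_ball :: "(real ^ 'n) set \<Rightarrow> (real ^ 'n) set" where
  "vrad_ball K = (\<lambda>x. vrad K *\<^sub>R x) ` cball 0 1"

definition orlicz_mean_radius :: "(real \<Rightarrow> real) \<Rightarrow> (real ^ 'n) set \<Rightarrow> real" where
  "orlicz_mean_radius \<phi> K =
     1 / (real CARD('n) * measure lborel (cball 0 1 :: (real ^ 'n) set)) *
     (LINT u|spherical_measure. \<phi> (radial_function K u))"

definition origin_symmetric_ball :: "(real ^ 'n) set \<Rightarrow> bool" where
  "origin_symmetric_ball K \<longleftrightarrow> (\<exists>r>0. K = (\<lambda>x. r *\<^sub>R x) ` cball 0 1)"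

definition strictly_convex_on :: "'a::real_vector set \<Rightarrow> ('a \<Rightarrow> real) \<Rightarrow> bool" where
  "strictly_convex_on S f \<longleftrightarrow> convex S \<and>
     (\<forall>x\<in>S. \<forall>y\<in>S. \<forall>u>0. \<forall>v>0. x \<noteq> y \<longrightarrow> u + v = 1 \<longrightarrow>
        f (u *\<^sub>R x + v *\<^sub>R y) < u * f x + v * f y)"

definition strictly_concave_on :: "'a::real_vector set \<Rightarrow> ('a \<Rightarrow> real) \<Rightarrow> bool" where
  "strictly_concave_on S f \<longleftrightarrow> strictly_convex_on S (\<lambda>x. - f x)"

end

theory Submission
  imports Defs "HOL-Probability.Probability_Measure"
begin

text \<open>
  With \<open>\<sigma>\<close> normalised to a probability measure, polar coordinates give \<open>vrad(K)\<^sup>n = E[\<rho>\<^sub>K\<^sup>n]\<close>, so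
  for \<open>\<phi>(t) = F(t\<^sup>n)\<close> the claim compares \<open>E[F(\<rho>\<^sub>K\<^sup>n)]\<close> with \<open>F(E[\<rho>\<^sub>K\<^sup>n])\<close>: it is Jensen's inequality.
  If \<open>F\<close> is strictly convex, equality forces \<open>\<rho>\<^sub>K\<close> to be constant almost everywhere, hence
  everywhere, because \<open>\<rho>\<^sub>K\<close> is continuous and \<open>\<sigma>\<close> charges nonempty open sets.

  As \<open>\<sigma>\<close> is a cone measure, the polar formula follows from Tonelli and scaling: averaging the
  ray integrals \<open>\<integral> r\<^sup>n\<^sup>-\<^sup>1 f(r x/|x|) dr\<close> over the unit ball and substituting \<open>r = s|x|\<close>, \<open>y = s x\<close>
  leaves \<open>f(y)\<close> with the weight \<open>|y|\<^sup>n s\<^sup>-\<^sup>n\<^sup>-\<^sup>1\<close> on \<open>s \<ge> |y|\<close>, whose integral over \<open>s\<close> is \<open>1/n\<close>.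
\<close>

lemma nn_integral_lborel_scaleR:
  fixes f :: "'a::euclidean_space \<Rightarrow> ennreal"
  assumes [measurable]: "f \<in> borel_measurable borel" and c: "c > 0"
  shows "(\<integral>\<^sup>+x. f x \<partial>lborel) = (\<integral>\<^sup>+x. ennreal (c ^ DIM('a)) * f (c *\<^sub>R x) \<partial>lborel)"
  using c by (subst lborel_affine[of c 0]) (auto simp: nn_integral_density nn_integral_distr)

lemma nn_integral_Ioi_power_scale:
  fixes h :: "real \<Rightarrow> ennreal"
  assumes [measurable]: "h \<in> borel_measurable borel" and c: "c > 0" and k: "k > 0"
  shows "(\<integral>\<^sup>+r\<in>{0<..}. ennreal (r ^ (k - 1)) * h r \<partial>lborel) =
    (\<integral>\<^sup>+s\<in>{0<..}. ennreal (s ^ (k - 1) * c ^ k) * h (c * s) \<partial>lborel)"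
proof -
  have "c * (c * s) ^ (k - 1) = s ^ (k - 1) * c ^ k" for s
    using k by (cases k) (simp_all add: power_mult_distrib)
  then have weight: "ennreal c * ennreal ((c * s) ^ (k - 1)) = ennreal (s ^ (k - 1) * c ^ k)" for s
    using c by (simp flip: ennreal_mult')
  have "(\<integral>\<^sup>+r\<in>{0<..}. ennreal (r ^ (k - 1)) * h r \<partial>lborel) =
      (\<integral>\<^sup>+s. ennreal c *
        (ennreal ((c * s) ^ (k - 1)) * h (c * s) * indicator {0<..} (c * s)) \<partial>lborel)"
    using c by (subst nn_integral_real_affine[where c = c and t = 0])
      (simp_all add: nn_integral_cmult)
  also have "\<dots> = (\<integral>\<^sup>+s\<in>{0<..}. ennreal (s ^ (k - 1) * c ^ k) * h (c * s) \<partial>lborel)"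
    unfolding mult.assoc[symmetric] weight
    using c by (intro nn_integral_cong) (simp add: indicator_def zero_less_mult_iff)
  finally show ?thesis .
qed

lemma nn_integral_power_tail:
  fixes a :: real
  assumes a: "a > 0" and k: "k > 0"
  shows "(\<integral>\<^sup>+s\<in>{a..}. ennreal (a ^ k / s ^ (k + 1)) \<partial>lborel) = ennreal (1 / real k)"
proof -
  let ?G = "\<lambda>s. - ((a / s) ^ k / real k)"
  have "(\<integral>\<^sup>+s\<in>{a..}. ennreal (a ^ k / s ^ (k + 1)) \<partial>lborel) = ennreal (0 - ?G a)"
  proof (rule nn_integral_FTC_atLeast[where F = ?G])
    fix s assume "a \<le> s"
    then have "DERIV (\<lambda>s. a / s) s :> - a / s\<^sup>2"
      using a by (auto intro!: derivative_eq_intros simp: power2_eq_square)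
    from DERIV_minus[OF DERIV_cdivide[OF DERIV_power[OF this]], of k "real k"]
    have "DERIV ?G s :> - (real k * (- a / s\<^sup>2 * (a / s) ^ (k - Suc 0)) / real k)" .
    also have "- (real k * (- a / s\<^sup>2 * (a / s) ^ (k - Suc 0)) / real k) = a ^ k / s ^ (k + 1)"
      using k by (cases k) (simp_all add: power_divide power2_eq_square)
    finally show "DERIV ?G s :> a ^ k / s ^ (k + 1)" .
  next
    have "((\<lambda>s. a / s) \<longlongrightarrow> 0) at_top"
      by (rule real_tendsto_divide_at_top[OF tendsto_const filterlim_ident])
    then have "((\<lambda>s. (a / s) ^ k) \<longlongrightarrow> 0) at_top"
      using k tendsto_power[of "\<lambda>s. a / s" 0 at_top k] by (simp add: zero_power)
    then have "(?G \<longlongrightarrow> - (0 / real k)) at_top"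
      using k by (intro tendsto_minus tendsto_divide tendsto_const) simp_all
    then show "(?G \<longlongrightarrow> 0) at_top"
      by simp
  qed (use a in auto)
  then show ?thesis
    using a by simp
qed

lemma nn_integral_power_Ioc:
  fixes b :: real
  assumes b: "b \<ge> 0" and k: "k > 0"
  shows "(\<integral>\<^sup>+r\<in>{0<..b}. ennreal (r ^ (k - 1)) \<partial>lborel) = ennreal (b ^ k / real k)"
proof -
  have "(\<integral>\<^sup>+r\<in>{0<..b}. ennreal (r ^ (k - 1)) \<partial>lborel) =
      (\<integral>\<^sup>+r\<in>{0..b}. ennreal (r ^ (k - 1)) \<partial>lborel)"
    by (intro nn_integral_cong_AE, use AE_lborel_singleton[of 0] in eventually_elim)
      (auto simp: indicator_def)
  also have "\<dots> = ennreal (b ^ k / real k - 0 ^ k / real k)"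
    using b k by (intro nn_integral_FTC_Icc) (auto intro!: derivative_eq_intros)
  finally show ?thesis
    using k by (simp add: zero_power)
qed

lemma nn_integral_spherical_measure:
  fixes h :: "real ^ 'n \<Rightarrow> ennreal"
  assumes [measurable]: "h \<in> borel_measurable borel"
  shows "(\<integral>\<^sup>+u. h u \<partial>spherical_measure) =
    of_nat CARD('n) * (\<integral>\<^sup>+x\<in>cball 0 1 - {0}. h (x /\<^sub>R norm x) \<partial>lborel)"
proof -
  have "(\<lambda>x. h (x /\<^sub>R norm x)) \<in> borel_measurable (restrict_space lborel (cball 0 1 - {0}))"
    by (rule measurable_restrict_space1) measurable
  moreover have "h \<in> borel_measurable (restrict_space borel (sphere 0 1))"
    by (rule measurable_restrict_space1) measurable
  ultimately show ?thesis
    unfolding spherical_measure_def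
    by (simp add: nn_integral_distr[OF measurable_radial_projection] nn_integral_scale_measure
        nn_integral_restrict_space)
qed

lemma nn_integral_scaleR_unit_ball:
  fixes f :: "'a::euclidean_space \<Rightarrow> ennreal"
  assumes [measurable]: "f \<in> borel_measurable borel" and s: "s > 0"
  shows "(\<integral>\<^sup>+x\<in>cball 0 1 - {0}.
      ennreal (s ^ (DIM('a) - 1) * norm x ^ DIM('a)) * f (s *\<^sub>R x) \<partial>lborel) =
    (\<integral>\<^sup>+y\<in>cball 0 s - {0}. ennreal (norm y ^ DIM('a) / s ^ (DIM('a) + 1)) * f y \<partial>lborel)"
proof -
  let ?n = "DIM('a)"
  let ?g = "\<lambda>y. ennreal (norm y ^ ?n / s ^ (?n + 1)) * f y * indicator (cball 0 s - {0}) y"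
  have "s ^ ?n = s ^ (?n - 1) * s"
    by (simp flip: power_Suc2)
  then have "s ^ ?n * (norm (s *\<^sub>R x) ^ ?n / s ^ (?n + 1)) = s ^ (?n - 1) * norm x ^ ?n" for x :: 'a
    using s by (simp add: power_mult_distrib)
  then have weight: "ennreal (s ^ ?n) * ennreal (norm (s *\<^sub>R x) ^ ?n / s ^ (?n + 1)) =
      ennreal (s ^ (?n - 1) * norm x ^ ?n)" for x :: 'a
    using s by (subst ennreal_mult[symmetric]) simp_all
  have "(\<integral>\<^sup>+y. ?g y \<partial>lborel) = (\<integral>\<^sup>+x. ennreal (s ^ ?n) * ?g (s *\<^sub>R x) \<partial>lborel)"
    by (rule nn_integral_lborel_scaleR[OF _ s])
      (intro borel_measurable_times_ennreal borel_measurable_indicator; measurable)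
  also have "\<dots> = (\<integral>\<^sup>+x\<in>cball 0 1 - {0}. ennreal (s ^ (?n - 1) * norm x ^ ?n) * f (s *\<^sub>R x) \<partial>lborel)"
    unfolding mult.assoc[symmetric] weight
    using s by (intro nn_integral_cong) (simp add: indicator_def)
  finally show ?thesis
    by (rule sym)
qed

lemma nn_integral_weighted_cballs:
  fixes f :: "'a::euclidean_space \<Rightarrow> ennreal"
  assumes [measurable]: "f \<in> borel_measurable borel" and k: "k > 0"
  shows "(\<integral>\<^sup>+s\<in>{0<..}.
      (\<integral>\<^sup>+y\<in>cball 0 s - {0}. ennreal (norm y ^ k / s ^ (k + 1)) * f y \<partial>lborel) \<partial>lborel) =
    ennreal (1 / real k) * (\<integral>\<^sup>+y. f y \<partial>lborel)"
proof -
  let ?V = "\<lambda>s y. ennreal (norm y ^ k / s ^ (k + 1)) * f y * indicator {y. y \<noteq> 0 \<and> norm y \<le> s} y"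
  have ball: "(\<integral>\<^sup>+y\<in>cball 0 s - {0}. ennreal (norm y ^ k / s ^ (k + 1)) * f y \<partial>lborel) *
      indicator {0<..} s = (\<integral>\<^sup>+y. ?V s y \<partial>lborel)" for s
  proof -
    have "indicator {y. y \<noteq> 0 \<and> norm y \<le> s} y =
        (indicator (cball 0 s - {0}) y * indicator {0<..} s :: ennreal)" for y :: 'a
      using zero_less_norm_iff[of y] by (auto simp: indicator_def simp del: zero_less_norm_iff)
    then show ?thesis
      by (cases "s > 0") simp_all
  qed
  have tail: "(\<integral>\<^sup>+s. ?V s y \<partial>lborel) = ennreal (1 / real k) * f y" if y: "y \<noteq> 0" for y
  proof -
    have "(\<integral>\<^sup>+s. ?V s y \<partial>lborel) =
        (\<integral>\<^sup>+s. (ennreal (norm y ^ k / s ^ (k + 1)) * indicator {norm y..} s) * f y \<partial>lborel)"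
      using y by (intro nn_integral_cong) (auto simp: indicator_def)
    also have "\<dots> = (\<integral>\<^sup>+s\<in>{norm y..}. ennreal (norm y ^ k / s ^ (k + 1)) \<partial>lborel) * f y"
      by (rule nn_integral_multc) measurable
    also have "(\<integral>\<^sup>+s\<in>{norm y..}. ennreal (norm y ^ k / s ^ (k + 1)) \<partial>lborel) = ennreal (1 / real k)"
      using y k by (intro nn_integral_power_tail) simp_all
    finally show ?thesis .
  qed
  have "(\<integral>\<^sup>+s. \<integral>\<^sup>+y. ?V s y \<partial>lborel \<partial>lborel) = (\<integral>\<^sup>+y. \<integral>\<^sup>+s. ?V s y \<partial>lborel \<partial>lborel)"
    by (rule lborel_pair.Fubini'[symmetric]) measurable
  also have "\<dots> = (\<integral>\<^sup>+y. ennreal (1 / real k) * f y \<partial>lborel)"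
    by (intro nn_integral_cong_AE, use AE_lborel_singleton[of 0] in eventually_elim) (rule tail)
  also have "\<dots> = ennreal (1 / real k) * (\<integral>\<^sup>+y. f y \<partial>lborel)"
    by (rule nn_integral_cmult) measurable
  finally show ?thesis
    by (simp only: ball)
qed

lemma nn_integral_polar:
  fixes f :: "real ^ 'n \<Rightarrow> ennreal"
  assumes [measurable]: "f \<in> borel_measurable borel"
  shows "(\<integral>\<^sup>+x. f x \<partial>lborel) =
    (\<integral>\<^sup>+u. (\<integral>\<^sup>+r\<in>{0<..}. ennreal (r ^ (CARD('n) - 1)) * f (r *\<^sub>R u) \<partial>lborel) \<partial>spherical_measure)"
proof -
  let ?n = "CARD('n)"
  let ?B = "cball 0 1 - {0 :: real ^ 'n}"
  let ?P = "\<lambda>u. \<integral>\<^sup>+r\<in>{0<..}. ennreal (r ^ (?n - 1)) * f (r *\<^sub>R u) \<partial>lborel"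
  let ?W = "\<lambda>s x. ennreal (s ^ (?n - 1) * norm x ^ ?n) * f (s *\<^sub>R x)"
  have [measurable]: "?B \<in> sets borel"
    by simp
  have ray: "?P (x /\<^sub>R norm x) * indicator ?B x =
      (\<integral>\<^sup>+s. ?W s x * indicator {0<..} s * indicator ?B x \<partial>lborel)" for x
  proof (cases "x = 0")
    case False
    then have dir: "(norm x * s) *\<^sub>R (x /\<^sub>R norm x) = s *\<^sub>R x" for s
      by (simp add: field_simps)
    have "?P (x /\<^sub>R norm x) = (\<integral>\<^sup>+s\<in>{0<..}. ennreal (s ^ (?n - 1) * norm x ^ ?n) *
        f ((norm x * s) *\<^sub>R (x /\<^sub>R norm x)) \<partial>lborel)"
      using False by (intro nn_integral_Ioi_power_scale) auto
    then show ?thesis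
      unfolding dir by (simp only:) (rule nn_integral_multc[symmetric], measurable)
  qed simp
  have ball: "(\<integral>\<^sup>+x. ?W s x * indicator {0<..} s * indicator ?B x \<partial>lborel) =
      (\<integral>\<^sup>+y\<in>cball 0 s - {0}. ennreal (norm y ^ ?n / s ^ (?n + 1)) * f y \<partial>lborel) *
      indicator {0<..} s" for s
    using nn_integral_scaleR_unit_ball[of f s] by (cases "s > 0") simp_all
  have "(\<integral>\<^sup>+u. ?P u \<partial>spherical_measure) =
      of_nat ?n * (\<integral>\<^sup>+x. \<integral>\<^sup>+s. ?W s x * indicator {0<..} s * indicator ?B x \<partial>lborel \<partial>lborel)"
    by (subst nn_integral_spherical_measure) (measurable, simp only: ray)
  also have "(\<integral>\<^sup>+x. \<integral>\<^sup>+s. ?W s x * indicator {0<..} s * indicator ?B x \<partial>lborel \<partial>lborel) =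
      (\<integral>\<^sup>+s. \<integral>\<^sup>+x. ?W s x * indicator {0<..} s * indicator ?B x \<partial>lborel \<partial>lborel)"
    by (rule lborel_pair.Fubini') measurable
  also have "\<dots> = ennreal (1 / real ?n) * (\<integral>\<^sup>+y. f y \<partial>lborel)"
    by (simp only: ball nn_integral_weighted_cballs[OF assms zero_less_card_finite])
  finally show ?thesis
    by (simp add: ennreal_of_nat_eq_real_of_nat flip: ennreal_mult mult.assoc)
qed

lemma emeasure_lborel_radial_body:
  fixes K :: "(real ^ 'n) set"
  assumes [measurable]: "K \<in> sets borel"
    and ray: "\<And>u r. norm u = 1 \<Longrightarrow> r > 0 \<Longrightarrow> r *\<^sub>R u \<in> K \<longleftrightarrow> r \<le> \<rho> u"
    and nonneg: "\<And>u. norm u = 1 \<Longrightarrow> \<rho> u \<ge> 0"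
  shows "emeasure lborel K = (\<integral>\<^sup>+u. ennreal (\<rho> u ^ CARD('n) / real CARD('n)) \<partial>spherical_measure)"
proof -
  have "emeasure lborel K = (\<integral>\<^sup>+u.
      (\<integral>\<^sup>+r\<in>{0<..}. ennreal (r ^ (CARD('n) - 1)) * indicator K (r *\<^sub>R u) \<partial>lborel)
      \<partial>spherical_measure)"
    by (subst nn_integral_polar[symmetric]) simp_all
  also have "\<dots> = (\<integral>\<^sup>+u. ennreal (\<rho> u ^ CARD('n) / real CARD('n)) \<partial>spherical_measure)"
  proof (rule nn_integral_cong)
    fix u :: "real ^ 'n"
    assume "u \<in> space spherical_measure"
    then have u: "norm u = 1"
      by (simp add: space_spherical_measure)
    have "(\<integral>\<^sup>+r\<in>{0<..}. ennreal (r ^ (CARD('n) - 1)) * indicator K (r *\<^sub>R u) \<partial>lborel) =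
        (\<integral>\<^sup>+r\<in>{0<..\<rho> u}. ennreal (r ^ (CARD('n) - 1)) \<partial>lborel)"
      using ray[OF u] by (intro nn_integral_cong) (auto simp: indicator_def)
    then show "(\<integral>\<^sup>+r\<in>{0<..}. ennreal (r ^ (CARD('n) - 1)) * indicator K (r *\<^sub>R u) \<partial>lborel) =
        ennreal (\<rho> u ^ CARD('n) / real CARD('n))"
      using nonneg[OF u] by (simp only: nn_integral_power_Ioc zero_less_card_finite)
  qed
  finally show ?thesis .
qed

definition normalized_spherical_measure :: "(real ^ 'n) measure" where
  "normalized_spherical_measure = density spherical_measure
     (\<lambda>_. ennreal (1 / (real CARD('n) * measure lborel (cball 0 1 :: (real ^ 'n) set))))"

lemma space_normalized_spherical_measure:
  "space (normalized_spherical_measure :: (real ^ 'n) measure) = sphere 0 1"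
  by (simp add: normalized_spherical_measure_def space_spherical_measure)

lemma prob_space_normalized_spherical_measure:
  "prob_space (normalized_spherical_measure :: (real ^ 'n) measure)"
proof (rule prob_spaceI)
  let ?\<sigma> = "spherical_measure :: (real ^ 'n) measure"
  let ?\<mu> = "normalized_spherical_measure :: (real ^ 'n) measure"
  let ?\<omega> = "measure lborel (cball 0 1 :: (real ^ 'n) set)"
  have "emeasure ?\<sigma> (space ?\<sigma>) = ennreal (real CARD('n) * ?\<omega>)"
    by (simp add: space_spherical_measure emeasure_spherical_measure_sphere ennreal_mult
        ennreal_of_nat_eq_real_of_nat emeasure_cball content_cball)
  moreover have "?\<omega> > 0"
    by simp
  ultimately show "emeasure ?\<mu> (space ?\<mu>) = 1"
    by (simp add: normalized_spherical_measure_def emeasure_density_const flip: ennreal_mult)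
qed

lemma borel_measurable_spherical_measure_continuous:
  assumes "continuous_on (sphere 0 1) g"
  shows "g \<in> borel_measurable (spherical_measure :: (real ^ 'n) measure)"
  using borel_measurable_continuous_on_restrict[OF assms]
  by (simp cong: measurable_cong_sets add: sets_spherical_measure)

lemma integral_normalized_spherical_measure:
  fixes g :: "real ^ 'n \<Rightarrow> real"
  assumes "g \<in> borel_measurable spherical_measure"
  shows "(LINT u|normalized_spherical_measure. g u) =
    1 / (real CARD('n) * measure lborel (cball 0 1 :: (real ^ 'n) set)) *
    (LINT u|spherical_measure. g u)"
  unfolding normalized_spherical_measure_def using assms by (subst integral_density) simp_all

lemma integrable_normalized_spherical_measure_continuous:
  fixes g :: "real ^ 'n \<Rightarrow> real"
  assumes g: "continuous_on (sphere 0 1) g"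
  shows "integrable normalized_spherical_measure g"
proof -
  interpret prob_space "normalized_spherical_measure :: (real ^ 'n) measure"
    by (rule prob_space_normalized_spherical_measure)
  obtain B where "\<And>u. u \<in> sphere 0 1 \<Longrightarrow> norm (g u) \<le> B"
    using compact_imp_bounded[OF compact_continuous_image[OF g compact_sphere]]
    by (meson bounded_iff imageI)
  moreover have "g \<in> borel_measurable normalized_spherical_measure"
    using borel_measurable_spherical_measure_continuous[OF g]
    by (simp add: normalized_spherical_measure_def)
  ultimately show ?thesis
    by (intro integrable_const_bound[where B = B]) (auto simp: space_normalized_spherical_measure)
qed

lemma emeasure_spherical_measure_openin_pos:
  fixes W :: "(real ^ 'n) set"
  assumes W: "openin (top_of_set (sphere 0 1)) W" "W \<noteq> {}"
  shows "emeasure spherical_measure W > 0"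
proof -
  obtain U where U: "open U" "W = sphere 0 1 \<inter> U"
    using W(1) by (auto simp: openin_open)
  define C where "C = (ball 0 1 - {0}) \<inter> (\<lambda>x. x /\<^sub>R norm x) -` U"
  have "open C"
    unfolding C_def using U(1) by (intro continuous_open_preimage continuous_intros) auto
  moreover obtain u where "u \<in> W"
    using W(2) by blast
  then have "(1 / 2) *\<^sub>R u \<in> C"
    by (auto simp: C_def U(2))
  ultimately have "emeasure lborel C \<noteq> 0"
    using open_not_negligible[of C] negligible_iff_emeasure0[of C] by (auto simp: borel_open)
  then have "0 < of_nat CARD('n) * emeasure lborel C"
    by (simp add: zero_less_iff_neq_zero)
  also have "emeasure lborel C \<le> (\<integral>\<^sup>+x\<in>cball 0 1 - {0}. indicator U (x /\<^sub>R norm x) \<partial>lborel)"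
  proof -
    have "emeasure lborel C = (\<integral>\<^sup>+x. indicator C x \<partial>lborel)"
      using \<open>open C\<close> by simp
    also have "\<dots> \<le> (\<integral>\<^sup>+x\<in>cball 0 1 - {0}. indicator U (x /\<^sub>R norm x) \<partial>lborel)"
      by (intro nn_integral_mono) (auto simp: C_def indicator_def)
    finally show ?thesis .
  qed
  then have "of_nat CARD('n) * emeasure lborel C \<le> (\<integral>\<^sup>+u. indicator U u \<partial>spherical_measure)"
    using U(1) by (simp add: nn_integral_spherical_measure borel_open mult_left_mono)
  also have "\<dots> = (\<integral>\<^sup>+u. indicator W u \<partial>spherical_measure)"
    by (intro nn_integral_cong) (auto simp: U(2) space_spherical_measure indicator_def)
  also have "\<dots> = emeasure spherical_measure W"
    using U by (intro nn_integral_indicator) (auto simp: sets_spherical_measure sets_restrict_space)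
  finally show ?thesis .
qed

lemma AE_normalized_spherical_measure_eq_imp_eq:
  fixes f g :: "real ^ 'n \<Rightarrow> 'b::t2_space"
  assumes f: "continuous_on (sphere 0 1) f" and g: "continuous_on (sphere 0 1) g"
    and AE: "AE u in normalized_spherical_measure. f u = g u" and u: "norm u = 1"
  shows "f u = g u"
proof (rule ccontr)
  define W where "W = sphere 0 1 \<inter> (\<lambda>u. (f u, g u)) -` {(x, y) |x y. x \<noteq> y}"
  assume "f u \<noteq> g u"
  then have "W \<noteq> {}"
    using u by (auto simp: W_def)
  have open_W: "openin (top_of_set (sphere 0 1)) W"
    unfolding W_def
    by (rule continuous_openin_preimage_gen[OF continuous_on_Pair[OF f g] open_diagonal_complement])
  then obtain U where "open U" "W = sphere 0 1 \<inter> U"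
    unfolding openin_open by blast
  then have sets_W: "W \<in> sets spherical_measure"
    by (auto simp: sets_spherical_measure sets_restrict_space)
  have "AE u in spherical_measure. f u = g u"
    using AE unfolding normalized_spherical_measure_def by (simp add: AE_density)
  then have "AE u in spherical_measure. u \<notin> W"
    by (rule eventually_mono) (simp add: W_def)
  then have "W \<in> null_sets spherical_measure"
    using AE_iff_null_sets[OF sets_W] by blast
  then show False
    using emeasure_spherical_measure_openin_pos[OF open_W \<open>W \<noteq> {}\<close>] by auto
qed

lemma scaleR_mem_iff_le_radial_function:
  fixes K :: "(real ^ 'n) set"
  assumes K: "compact K" "K \<noteq> {}" "\<And>x. x \<in> K \<Longrightarrow> closed_segment 0 x \<subseteq> K"
    and u: "norm u = 1" and r: "r \<ge> 0"
  shows "r *\<^sub>R u \<in> K \<longleftrightarrow> r \<le> radial_function K u"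
proof -
  let ?L = "(\<lambda>l. l *\<^sub>R u) -` K"
  obtain b where b: "\<And>x. x \<in> K \<Longrightarrow> norm x \<le> b"
    using compact_imp_bounded[OF K(1)] by (auto simp: bounded_iff)
  have "closed ?L"
    using compact_imp_closed[OF K(1)] by (intro continuous_closed_vimage) auto
  moreover have "bounded ?L"
    unfolding bounded_iff using b u by (intro exI[of _ b]) fastforce
  ultimately have "compact ?L"
    by (simp add: compact_eq_bounded_closed)
  moreover have "0 \<in> ?L"
    using K(2,3) by auto
  ultimately obtain m where m: "m *\<^sub>R u \<in> K" "\<And>l. l *\<^sub>R u \<in> K \<Longrightarrow> l \<le> m"
    using compact_attains_sup[of ?L] by blast
  then have "radial_function K u = m"
    unfolding radial_function_def by (intro Greatest_equality)
  moreover have "r *\<^sub>R u \<in> K" if "r \<le> m"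
  proof -
    have "r *\<^sub>R u = (r / m) *\<^sub>R m *\<^sub>R u"
      using that r by auto
    moreover have "0 \<le> r / m" "r / m \<le> 1"
      using that r by (auto simp: divide_le_eq_1)
    ultimately have "r *\<^sub>R u \<in> closed_segment 0 (m *\<^sub>R u)"
      by (auto simp: in_segment)
    then show ?thesis
      using K(3)[OF m(1)] by blast
  qed
  ultimately show ?thesis
    using m(2) by blast
qed

lemma star_body_scaleR_mem_iff:
  fixes K :: "(real ^ 'n) set"
  assumes "star_body K" "norm u = 1" "r \<ge> 0"
  shows "r *\<^sub>R u \<in> K \<longleftrightarrow> r \<le> radial_function K u"
  using assms by (intro scaleR_mem_iff_le_radial_function) (auto simp: star_body_def)

lemma continuous_on_radial_power:
  fixes K :: "(real ^ 'n) set"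
  assumes K: "star_body K" and F: "continuous_on {0<..} F"
  shows "continuous_on (sphere 0 1) (\<lambda>u. F (radial_function K u ^ CARD('n)))"
  using K by (intro continuous_on_compose2[OF F] continuous_on_power) (auto simp: star_body_def)

lemma star_body_eq_cball_if_radial_function_const:
  fixes K :: "(real ^ 'n) set"
  assumes K: "star_body K" and radial: "\<And>u. norm u = 1 \<Longrightarrow> radial_function K u = c"
  shows "K = cball 0 c"
proof (rule set_eqI)
  fix x :: "real ^ 'n"
  have "\<exists>u. norm u = 1 \<and> norm x *\<^sub>R u = x"
  proof (cases "x = 0")
    case True
    then show ?thesis
      using vector_choose_size[of 1] by auto
  next
    case False
    then show ?thesis
      by (intro exI[of _ "x /\<^sub>R norm x"]) simp
  qed
  then obtain u where u: "norm u = 1" "norm x *\<^sub>R u = x"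
    by blast
  then have "x \<in> K \<longleftrightarrow> norm x \<le> c"
    using star_body_scaleR_mem_iff[OF K u(1), of "norm x"] radial[OF u(1)] by simp
  then show "x \<in> K \<longleftrightarrow> x \<in> cball 0 c"
    by simp
qed

lemma integral_radial_function_power:
  fixes K :: "(real ^ 'n) set"
  assumes K: "star_body K"
  shows "(LINT u|normalized_spherical_measure. radial_function K u ^ CARD('n)) =
    measure lborel K / measure lborel (cball 0 1 :: (real ^ 'n) set)"
proof -
  let ?n = "CARD('n)"
  let ?\<rho> = "radial_function K"
  have meas: "(\<lambda>u. ?\<rho> u ^ ?n) \<in> borel_measurable spherical_measure"
    by (rule borel_measurable_spherical_measure_continuous[OF
          continuous_on_radial_power[OF K continuous_on_id]])
  have nonneg: "\<And>u. norm u = 1 \<Longrightarrow> ?\<rho> u \<ge> 0"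
    using K by (simp add: star_body_def less_imp_le)
  have "K \<in> sets borel"
    using K by (simp add: star_body_def borel_compact)
  then have "emeasure lborel K = (\<integral>\<^sup>+u. ennreal (?\<rho> u ^ ?n / real ?n) \<partial>spherical_measure)"
    using star_body_scaleR_mem_iff[OF K] nonneg by (intro emeasure_lborel_radial_body) simp_all
  moreover have "(LINT u|spherical_measure. ?\<rho> u ^ ?n / real ?n) =
      enn2real (\<integral>\<^sup>+u. ennreal (?\<rho> u ^ ?n / real ?n) \<partial>spherical_measure)"
  proof (rule integral_eq_nn_integral)
    show "(\<lambda>u. ?\<rho> u ^ ?n / real ?n) \<in> borel_measurable spherical_measure"
      using meas by measurable
    show "AE u in spherical_measure. 0 \<le> ?\<rho> u ^ ?n / real ?n"
      using nonneg by (intro AE_I2) (simp add: space_spherical_measure)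
  qed
  ultimately have "measure lborel K = (LINT u|spherical_measure. ?\<rho> u ^ ?n / real ?n)"
    by (simp add: measure_def)
  then show ?thesis
    by (simp add: integral_normalized_spherical_measure[OF meas])
qed

lemma vrad_power:
  fixes K :: "(real ^ 'n) set"
  assumes K: "star_body K"
  shows "vrad K ^ CARD('n) = (LINT u|normalized_spherical_measure. radial_function K u ^ CARD('n))"
  unfolding vrad_def integral_radial_function_power[OF K]
  by (rule real_root_pow_pos2) simp_all

lemma vrad_pos:
  fixes K :: "(real ^ 'n) set"
  assumes K: "star_body K"
  shows "vrad K > 0"
proof -
  interpret prob_space "normalized_spherical_measure :: (real ^ 'n) measure"
    by (rule prob_space_normalized_spherical_measure)
  have "expectation (\<lambda>u. radial_function K u ^ CARD('n)) > 0"
  proof (rule expectation_greater)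
    show "integrable normalized_spherical_measure (\<lambda>u. radial_function K u ^ CARD('n))"
      by (rule integrable_normalized_spherical_measure_continuous[OF
            continuous_on_radial_power[OF K continuous_on_id]])
    show "AE u in normalized_spherical_measure. 0 < radial_function K u ^ CARD('n)"
      using K by (intro AE_I2) (simp add: star_body_def space_normalized_spherical_measure)
  qed
  then show ?thesis
    by (simp add: vrad_def integral_radial_function_power[OF K])
qed

lemma orlicz_mean_radius_cong:
  fixes K :: "(real ^ 'n) set"
  assumes "star_body K" "\<And>t. t > 0 \<Longrightarrow> \<phi> t = \<psi> t"
  shows "orlicz_mean_radius \<phi> K = orlicz_mean_radius \<psi> K"
  unfolding orlicz_mean_radius_def using assms
  by (intro arg_cong[where f = "(*) _"] Bochner_Integration.integral_cong)
    (auto simp: star_body_def space_spherical_measure)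

lemma orlicz_mean_radius_uminus: "orlicz_mean_radius (\<lambda>t. - \<phi> t) K = - orlicz_mean_radius \<phi> K"
  by (simp add: orlicz_mean_radius_def)

lemma radial_function_cball:
  fixes u :: "real ^ 'n"
  assumes "r \<ge> 0" "norm u = 1"
  shows "radial_function (cball 0 r) u = r"
  unfolding radial_function_def using assms by (intro Greatest_equality) auto

lemma vrad_cball:
  assumes "r \<ge> 0"
  shows "vrad (cball 0 r :: (real ^ 'n) set) = r"
  using assms by (simp add: vrad_def content_cball real_root_power_cancel
      less_imp_neq[OF unit_ball_vol_pos, symmetric])

lemma orlicz_mean_radius_cball:
  assumes "r \<ge> 0"
  shows "orlicz_mean_radius \<phi> (cball 0 r :: (real ^ 'n) set) = \<phi> r"
proof -
  interpret prob_space "normalized_spherical_measure :: (real ^ 'n) measure"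
    by (rule prob_space_normalized_spherical_measure)
  have "orlicz_mean_radius \<phi> (cball 0 r :: (real ^ 'n) set) =
      (LINT u|(normalized_spherical_measure :: (real ^ 'n) measure). \<phi> r)"
    unfolding orlicz_mean_radius_def
      integral_normalized_spherical_measure[OF borel_measurable_const]
    using assms by (intro arg_cong[where f = "(*) _"] Bochner_Integration.integral_cong)
      (auto simp: space_spherical_measure radial_function_cball)
  then show ?thesis
    by (simp add: prob_space)
qed

lemma star_body_cball:
  assumes "r > 0"
  shows "star_body (cball 0 r :: (real ^ 'n) set)"
proof -
  have "continuous_on (sphere 0 1) (radial_function (cball 0 r :: (real ^ 'n) set)) \<longleftrightarrow>
      continuous_on (sphere 0 1 :: (real ^ 'n) set) (\<lambda>_. r)"
    using assms by (intro continuous_on_cong) (auto simp: radial_function_cball)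
  moreover have "closed_segment 0 x \<subseteq> cball 0 r" if "x \<in> cball 0 r" for x :: "real ^ 'n"
    using that assms by (intro closed_segment_subset) auto
  ultimately show ?thesis
    using assms by (auto simp: star_body_def radial_function_cball)
qed

lemma vrad_ball_eq_cball: "vrad K > 0 \<Longrightarrow> vrad_ball K = cball 0 (vrad K)"
  by (simp add: vrad_ball_def cball_scale)

lemma star_body_vrad_ball: "star_body K \<Longrightarrow> star_body (vrad_ball K)"
  by (simp add: vrad_ball_eq_cball star_body_cball vrad_pos)

lemma origin_symmetric_ball_iff_cball: "origin_symmetric_ball K \<longleftrightarrow> (\<exists>r>0. K = cball 0 r)"
  by (simp add: origin_symmetric_ball_def cball_scale cong: conj_cong)

lemma strictly_convex_onD:
  assumes "strictly_convex_on S f" "x \<in> S" "y \<in> S" "x \<noteq> y" "u > 0" "v > 0" "u + v = 1"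
  shows "f (u *\<^sub>R x + v *\<^sub>R y) < u * f x + v * f y"
  using assms unfolding strictly_convex_on_def by blast

lemma strictly_convex_on_imp_convex_on:
  assumes "strictly_convex_on S f"
  shows "convex_on S f"
proof (rule convex_onI)
  show "convex S"
    using assms by (simp add: strictly_convex_on_def)
  fix t :: real and x y
  assume "0 < t" "t < 1" "x \<in> S" "y \<in> S"
  then show "f ((1 - t) *\<^sub>R x + t *\<^sub>R y) \<le> (1 - t) * f x + t * f y"
    using strictly_convex_onD[OF assms, of x y "1 - t" t]
    by (cases "x = y") (simp_all add: algebra_simps)
qed

lemma strictly_convex_on_above_tangent:
  fixes f :: "real \<Rightarrow> real"
  assumes f: "strictly_convex_on S f" and x: "x \<in> S" and y: "y \<in> S" "y \<noteq> x"
    and tangent: "\<And>z. z \<in> S \<Longrightarrow> f z \<ge> f x + c * (z - x)"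
  shows "f y > f x + c * (y - x)"
proof -
  let ?z = "(1/2) *\<^sub>R x + (1/2) *\<^sub>R y"
  have "f ?z < 1/2 * f x + 1/2 * f y"
    using x y by (intro strictly_convex_onD[OF f]) auto
  moreover have "?z \<in> S"
    using f x y unfolding strictly_convex_on_def by (intro convexD) auto
  then have "f ?z \<ge> f x + c * (?z - x)"
    by (rule tangent)
  ultimately show ?thesis
    by (simp add: field_simps)
qed

lemma (in prob_space) jensens_inequality_eq_imp_AE_const:
  fixes X :: "'a \<Rightarrow> real" and q :: "real \<Rightarrow> real"
  assumes X: "integrable M X" "AE x in M. X x \<in> I"
    and I: "expectation X \<in> interior I"
    and q: "integrable M (\<lambda>x. q (X x))" "strictly_convex_on I q"
    and eq: "expectation (\<lambda>x. q (X x)) = q (expectation X)"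
  shows "AE x in M. X x = expectation X"
proof -
  let ?m = "expectation X"
  obtain c where tangent: "\<And>y. y \<in> I \<Longrightarrow> q y \<ge> q ?m + c * (y - ?m)"
    using convex_le_Inf_differential[OF strictly_convex_on_imp_convex_on[OF q(2)] I] by blast
  let ?d = "\<lambda>x. q (X x) - (q ?m + c * (X x - ?m))"
  have d: "integrable M ?d" "AE x in M. 0 \<le> ?d x"
    using X q(1) tangent by auto
  have "expectation ?d = 0"
    using X(1) q(1) by (simp add: eq prob_space)
  then have "AE x in M. ?d x = 0"
    using integral_nonneg_eq_0_iff_AE[OF d] by simp
  with X(2) show ?thesis
  proof eventually_elim
    case (elim x)
    have "?m \<in> I"
      using I interior_subset by blast
    then show ?case
      using strictly_convex_on_above_tangent[OF q(2) _ elim(1) _ tangent] elim(2) by fastforce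
  qed
qed

lemma orlicz_mean_radius_eq_expectation:
  fixes K :: "(real ^ 'n) set"
  assumes K: "star_body K" and F: "continuous_on {0<..} F"
  shows "orlicz_mean_radius (\<lambda>t. F (t ^ CARD('n))) K =
    (LINT u|normalized_spherical_measure. F (radial_function K u ^ CARD('n)))"
  unfolding orlicz_mean_radius_def
  by (rule integral_normalized_spherical_measure[OF
        borel_measurable_spherical_measure_continuous[OF continuous_on_radial_power[OF K F]],
        symmetric])

lemma orlicz_mean_radius_vrad_ball:
  fixes K :: "(real ^ 'n) set"
  assumes K: "star_body K"
  shows "orlicz_mean_radius (\<lambda>t. F (t ^ CARD('n))) (vrad_ball K) =
    F (LINT u|normalized_spherical_measure. radial_function K u ^ CARD('n))"
  using vrad_pos[OF K] by (simp add: vrad_ball_eq_cball orlicz_mean_radius_cball vrad_power[OF K])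

lemma orlicz_mean_radius_ge_vrad_ball:
  fixes K :: "(real ^ 'n) set"
  assumes K: "star_body K" and F: "convex_on {0<..} F"
  shows "orlicz_mean_radius (\<lambda>t. F (t ^ CARD('n))) (vrad_ball K) \<le>
    orlicz_mean_radius (\<lambda>t. F (t ^ CARD('n))) K"
proof -
  have cont: "continuous_on {0<..} F"
    using F by (rule convex_on_continuous[rotated]) simp
  interpret prob_space "normalized_spherical_measure :: (real ^ 'n) measure"
    by (rule prob_space_normalized_spherical_measure)
  show ?thesis
    unfolding orlicz_mean_radius_vrad_ball[OF K] orlicz_mean_radius_eq_expectation[OF K cont]
    using K F
    by (intro jensens_inequality[where I = "{0<..}"] AE_I2
        integrable_normalized_spherical_measure_continuous
        continuous_on_radial_power[OF K cont] continuous_on_radial_power[OF K continuous_on_id])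
      (auto simp: star_body_def space_normalized_spherical_measure)
qed

lemma orlicz_mean_radius_eq_vrad_ball_imp_cball:
  fixes K :: "(real ^ 'n) set"
  assumes K: "star_body K" and F: "strictly_convex_on {0<..} F"
    and eq: "orlicz_mean_radius (\<lambda>t. F (t ^ CARD('n))) K =
      orlicz_mean_radius (\<lambda>t. F (t ^ CARD('n))) (vrad_ball K)"
  shows "K = cball 0 (vrad K)"
proof (rule star_body_eq_cball_if_radial_function_const[OF K])
  let ?X = "\<lambda>u. radial_function K u ^ CARD('n)"
  have cont: "continuous_on {0<..} F"
    using strictly_convex_on_imp_convex_on[OF F] by (rule convex_on_continuous[rotated]) simp
  have contX: "continuous_on (sphere 0 1) ?X"
    by (rule continuous_on_radial_power[OF K continuous_on_id])
  interpret prob_space "normalized_spherical_measure :: (real ^ 'n) measure"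
    by (rule prob_space_normalized_spherical_measure)
  have "AE u in normalized_spherical_measure. ?X u = expectation ?X"
  proof (rule jensens_inequality_eq_imp_AE_const[OF _ _ _ _ F])
    show "expectation ?X \<in> interior {0<..}"
      using vrad_pos[OF K] by (simp add: interior_open flip: vrad_power[OF K])
    show "expectation (\<lambda>u. F (?X u)) = F (expectation ?X)"
      using eq
      by (simp add: orlicz_mean_radius_vrad_ball[OF K] orlicz_mean_radius_eq_expectation[OF K cont])
    show "AE u in normalized_spherical_measure. ?X u \<in> {0<..}"
      using K by (intro AE_I2) (simp add: star_body_def space_normalized_spherical_measure)
  qed (intro integrable_normalized_spherical_measure_continuous contX
      continuous_on_radial_power[OF K cont])+
  then have "?X u = vrad K ^ CARD('n)" if "norm u = 1" for u
    using AE_normalized_spherical_measure_eq_imp_eq[OF contX continuous_on_const _ that]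
    by (simp add: vrad_power[OF K])
  then show "radial_function K u = vrad K" if "norm u = 1" for u
    using that K vrad_pos[OF K] by (simp add: star_body_def power_eq_iff_eq_base less_imp_le)
qed

lemma orlicz_mean_radius_eq_vrad_ball_iff:
  fixes K :: "(real ^ 'n) set"
  assumes K: "star_body K" and F: "strictly_convex_on {0<..} F"
  shows "orlicz_mean_radius (\<lambda>t. F (t ^ CARD('n))) K =
      orlicz_mean_radius (\<lambda>t. F (t ^ CARD('n))) (vrad_ball K) \<longleftrightarrow> origin_symmetric_ball K"
proof
  assume "origin_symmetric_ball K"
  then show "orlicz_mean_radius (\<lambda>t. F (t ^ CARD('n))) K =
      orlicz_mean_radius (\<lambda>t. F (t ^ CARD('n))) (vrad_ball K)"
    by (auto simp: origin_symmetric_ball_iff_cball vrad_ball_eq_cball vrad_cball)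
next
  assume "orlicz_mean_radius (\<lambda>t. F (t ^ CARD('n))) K =
      orlicz_mean_radius (\<lambda>t. F (t ^ CARD('n))) (vrad_ball K)"
  then show "origin_symmetric_ball K"
    unfolding origin_symmetric_ball_iff_cball
    using orlicz_mean_radius_eq_vrad_ball_imp_cball[OF K F] vrad_pos[OF K] by blast
qed

theorem theorem3p6:
  fixes K :: "(real ^ 'n) set" and \<phi> F :: "real \<Rightarrow> real"
  assumes "star_body K"
    and "continuous_on {0<..} \<phi>"
    and "\<And>t. t > 0 \<Longrightarrow> \<phi> t > 0"
    and "\<And>t. t > 0 \<Longrightarrow> F t = \<phi> (root CARD('n) t)"
  shows
    "(concave_on {0<..} F \<longrightarrow>
        orlicz_mean_radius \<phi> K \<le> orlicz_mean_radius \<phi> (vrad_ball K)) \<and>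
     (convex_on {0<..} F \<longrightarrow>
        orlicz_mean_radius \<phi> K \<ge> orlicz_mean_radius \<phi> (vrad_ball K)) \<and>
     (strictly_concave_on {0<..} F \<or> strictly_convex_on {0<..} F \<longrightarrow>
        (orlicz_mean_radius \<phi> K = orlicz_mean_radius \<phi> (vrad_ball K) \<longleftrightarrow>
          origin_symmetric_ball K))"
proof -
  note K = assms(1)
  have mean: "orlicz_mean_radius \<phi> L = orlicz_mean_radius (\<lambda>t. F (t ^ CARD('n))) L"
    if "star_body L" for L :: "(real ^ 'n) set"
    using that by (rule orlicz_mean_radius_cong) (simp add: assms(4) real_root_power_cancel)
  note convex = orlicz_mean_radius_ge_vrad_ball[OF K, of F]
    orlicz_mean_radius_eq_vrad_ball_iff[OF K, of F]
  note concave = orlicz_mean_radius_ge_vrad_ball[OF K, of "\<lambda>x. - F x"]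
    orlicz_mean_radius_eq_vrad_ball_iff[OF K, of "\<lambda>x. - F x"]
  show ?thesis
    unfolding mean[OF K] mean[OF star_body_vrad_ball[OF K]] concave_on_def strictly_concave_on_def
    using convex concave[unfolded orlicz_mean_radius_uminus] by auto
qed

end
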